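(* Let $\bar{x}\in\mathcal{F}$ be a locally optimal solution of (MPSC). Assume that the local error bound of (MPSC) holds at $\bar{x}$ with error bound constant $\alpha>0$. Then the penalty problem admits a local exact penalization at $\bar{x}$; more precisely, with $\bar\kappa:=\alpha L_f>0$, where $L_f$ is the Lipschitz constant of $f$ around $\bar{x}$, the point $\bar{x}$ is a locally optimal solution of the penalty problem with parameter $\kappa$ for all $\kappa>\bar\kappa$.
   Context: (MPSC) is the problem: minimize $f(x)$ over $x\in\mathbb{R}^n$ subject to $g_i(x)\le 0$ ($i=1,\dots,m$), $h_j(x)=0$ ($j=1,\dots,p$), $G_k(x)H_k(x)=0$ ($k=1,\dots,l$), where $f,g_i,h_j,G_k,H_k:\mathbb{R}^n\to\mathbb{R}$ are twice continuously differentiable. $\mathcal{F}$ denotes its feasible set. Put $g_i^+(x)=\max\{g_i(x),0\}$ and $$R(x)=\Big(\sum_{i=1}^m[g_i^+(x)]^2+\sum_{j=1}^p[h_j(x)]^2+\sum_{k=1}^l\min\{[G_k(x)]^2,[H_k(x)]^2\}\Big)^{1/2}.$$ The penalty problem with parameter $\kappa>0$ is the unconstrained problem of minimizing $f(x)+\kappa R(x)$ over $\mathbb{R}^n$. It admits a local exact penalization at a locally optimal solution $\bar{x}$ of (MPSC) if there is $\bar\kappa>0$ such that $\bar{x}$ is a locally optimal solution of the penalty problem for all $\kappa>\bar\kappa$. The local error bound of (MPSC) holds at $\bar{x}\in\mathcal{F}$ if there exist $\varepsilon,\alpha>0$ such that $\mathrm{dist}_{\mathcal{F}}(x)\le\alpha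 R(x)$ for all $x$ with $\|x-\bar{x}\|<\varepsilon$, where $\mathrm{dist}_{\mathcal{F}}(x)=\inf_{y\in\mathcal{F}}\|x-y\|$ (Euclidean norm); $\alpha$ is called the error bound constant. *)

theory Defs
  imports "HOL-Analysis.Analysis"
begin

definition twice_continuously_differentiable :: "('a::real_normed_vector \<Rightarrow> real) \<Rightarrow> bool" where
  "twice_continuously_differentiable \<phi> \<longleftrightarrow>
     (\<exists>(D1 :: 'a \<Rightarrow> 'a \<Rightarrow>\<^sub>L real) (D2 :: 'a \<Rightarrow> 'a \<Rightarrow>\<^sub>L 'a \<Rightarrow>\<^sub>L real).
        (\<forall>x. (\<phi> has_derivative blinfun_apply (D1 x)) (at x)) \<and>
        (\<forall>x. (D1 has_derivative blinfun_apply (D2 x)) (at x)) \<and>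
        continuous_on UNIV D2)"

definition locally_optimal_on :: "('a::metric_space \<Rightarrow> real) \<Rightarrow> 'a set \<Rightarrow> 'a \<Rightarrow> bool" where
  "locally_optimal_on \<phi> S x \<longleftrightarrow> x \<in> S \<and> (\<exists>\<delta>>0. \<forall>y\<in>S \<inter> ball x \<delta>. \<phi> x \<le> \<phi> y)"

text \<open>The constraints are indexed by the naturals from 1 to \<open>m\<close>, \<open>p\<close> and \<open>l\<close> respectively;
  values of the constraint families outside these ranges are irrelevant.\<close>

definition mpsc_feasible ::
  "nat \<Rightarrow> nat \<Rightarrow> nat \<Rightarrow> (nat \<Rightarrow> 'a \<Rightarrow> real) \<Rightarrow> (nat \<Rightarrow> 'a \<Rightarrow> real)
    \<Rightarrow> (nat \<Rightarrow> 'a \<Rightarrow> real) \<Rightarrow> (nat \<Rightarrow> 'a \<Rightarrow> real) \<Rightarrow> 'a set" where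
  "mpsc_feasible m p l g h G H =
     {x. (\<forall>i\<in>{1..m}. g i x \<le> 0) \<and> (\<forall>j\<in>{1..p}. h j x = 0) \<and> (\<forall>k\<in>{1..l}. G k x * H k x = 0)}"

definition mpsc_residual ::
  "nat \<Rightarrow> nat \<Rightarrow> nat \<Rightarrow> (nat \<Rightarrow> 'a \<Rightarrow> real) \<Rightarrow> (nat \<Rightarrow> 'a \<Rightarrow> real)
    \<Rightarrow> (nat \<Rightarrow> 'a \<Rightarrow> real) \<Rightarrow> (nat \<Rightarrow> 'a \<Rightarrow> real) \<Rightarrow> 'a \<Rightarrow> real" where
  "mpsc_residual m p l g h G H x =
     sqrt ((\<Sum>i=1..m. (max (g i x) 0)\<^sup>2) + (\<Sum>j=1..p. (h j x)\<^sup>2)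
           + (\<Sum>k=1..l. min ((G k x)\<^sup>2) ((H k x)\<^sup>2)))"

definition solves_penalty_locally :: "('a::metric_space \<Rightarrow> real) \<Rightarrow> ('a \<Rightarrow> real) \<Rightarrow> real \<Rightarrow> 'a \<Rightarrow> bool" where
  "solves_penalty_locally f R \<kappa> x \<longleftrightarrow> locally_optimal_on (\<lambda>y. f y + \<kappa> * R y) UNIV x"

definition admits_local_exact_penalization :: "('a::metric_space \<Rightarrow> real) \<Rightarrow> ('a \<Rightarrow> real) \<Rightarrow> 'a \<Rightarrow> bool" where
  "admits_local_exact_penalization f R x \<longleftrightarrow> (\<exists>\<kappa>\<^sub>0>0. \<forall>\<kappa>>\<kappa>\<^sub>0. solves_penalty_locally f R \<kappa> x)"

text \<open>The local error bound with error bound constant \<open>\<alpha>\<close>. On nonempty sets, \<^const>\<open>infdist\<close> is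
  the usual infimum of distances; \<open>F\<close> contains \<open>x\<close> here.\<close>

definition local_error_bound :: "'a::metric_space set \<Rightarrow> ('a \<Rightarrow> real) \<Rightarrow> real \<Rightarrow> 'a \<Rightarrow> bool" where
  "local_error_bound F R \<alpha> x \<longleftrightarrow>
     x \<in> F \<and> \<alpha> > 0 \<and> (\<exists>\<epsilon>>0. \<forall>y. dist y x < \<epsilon> \<longrightarrow> infdist y F \<le> \<alpha> * R y)"

text \<open>Any positive constant valid on some neighbourhood of \<open>x\<close> counts as a Lipschitz constant
  around \<open>x\<close>; it need not be the least one. Positivity makes the penalty threshold positive
  also when \<open>f\<close> is locally constant.\<close>

definition lipschitz_constant_around :: "('a::metric_space \<Rightarrow> real) \<Rightarrow> 'a \<Rightarrow> real \<Rightarrow> bool" where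
  "lipschitz_constant_around f x L \<longleftrightarrow> L > 0 \<and> (\<exists>r>0. L-lipschitz_on (ball x r) f)"

end

theory Submission imports Defs begin

text \<open>
  The argument is Clarke's exact penalty principle. Let \<open>F\<close> be the feasible set and \<open>y\<close> a point near
  the local solution \<open>x\<close>. A point \<open>z\<close> of \<open>F\<close> that nearly realises the distance from \<open>y\<close> to \<open>F\<close> is
  itself near \<open>x\<close>, because \<open>x\<close> competes for that distance. So \<open>f x \<le> f z\<close> by local optimality, and
  \<open>f z \<le> f y + L * dist y z\<close> by the Lipschitz property; hence \<open>f x \<le> f y + L * infdist y F\<close>
  (\<open>lipschitz_distance_penalty\<close>). The error bound replaces the distance by \<open>\<alpha>\<close> times the residual, and
  the residual vanishes at \<open>x\<close>, so every \<open>\<kappa> \<ge> \<alpha> * L\<close> is an exact penalty parameter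
  (\<open>error_bound_imp_solves_penalty_locally\<close>). The smoothness of \<open>f\<close> serves to supply a Lipschitz
  constant, by the mean value inequality on a small ball.
\<close>

text \<open>A continuous derivative is bounded near each point, and a ball is convex, so the mean value
  inequality turns the bound into a Lipschitz constant.\<close>

lemma twice_continuously_differentiable_imp_lipschitz_constant:
  fixes f :: "'a::real_normed_vector \<Rightarrow> real"
  assumes "twice_continuously_differentiable f"
  shows "\<exists>L. lipschitz_constant_around f x L"
proof -
  obtain D1 :: "'a \<Rightarrow> 'a \<Rightarrow>\<^sub>L real" and D2 :: "'a \<Rightarrow> 'a \<Rightarrow>\<^sub>L 'a \<Rightarrow>\<^sub>L real" where
    D1: "\<And>x. (f has_derivative blinfun_apply (D1 x)) (at x)" and
    D2: "\<And>x. (D1 has_derivative blinfun_apply (D2 x)) (at x)"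
    using assms unfolding twice_continuously_differentiable_def by blast
  have "isCont D1 x"
    using D2 by (rule has_derivative_continuous)
  then obtain r where r: "r > 0" "\<And>y. dist y x < r \<Longrightarrow> dist (D1 y) (D1 x) < 1"
    unfolding continuous_at_eps_delta by (metis zero_less_one)
  define L where "L = norm (D1 x) + 1"
  have "L > 0"
    unfolding L_def by (smt (verit) norm_ge_zero)
  have "onorm (blinfun_apply (D1 y)) \<le> L" if "y \<in> ball x r" for y
  proof -
    have "norm (D1 y - D1 x) < 1"
      using r(2)[of y] that by (simp add: dist_norm norm_minus_commute)
    then show ?thesis
      unfolding L_def norm_blinfun.rep_eq[symmetric]
      using norm_triangle_sub[of "D1 y" "D1 x"] by linarith
  qed
  then have "norm (f u - f v) \<le> L * norm (u - v)" if "u \<in> ball x r" "v \<in> ball x r" for u v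
    using that
    by (intro differentiable_bound[where S = "ball x r" and f' = "\<lambda>y. blinfun_apply (D1 y)"])
      (auto intro: has_derivative_at_withinI[OF D1])
  then have "L-lipschitz_on (ball x r) f"
    using \<open>L > 0\<close> by (intro lipschitz_onI) (auto simp: dist_norm)
  then show ?thesis
    using \<open>L > 0\<close> \<open>r > 0\<close> unfolding lipschitz_constant_around_def by blast
qed

text \<open>The infimum defining the distance from \<open>y\<close> to \<open>F\<close> need not be attained in a metric space. So \<open>y\<close>
  is compared with points of \<open>F\<close> at distance below \<open>t\<close>, for every \<open>t\<close> above the infimum; the
  resulting bounds \<open>f x - f y \<le> L * t\<close> give the claim as \<open>t\<close> decreases to the infimum.\<close>

lemma lipschitz_distance_penalty:
  assumes opt: "locally_optimal_on f F x" and lip: "lipschitz_constant_around f x L"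
  shows "\<exists>\<rho>>0. \<forall>y\<in>ball x \<rho>. f x \<le> f y + L * infdist y F"
proof -
  obtain \<delta> where \<delta>: "x \<in> F" "\<delta> > 0" "\<And>z. z \<in> F \<Longrightarrow> dist x z < \<delta> \<Longrightarrow> f x \<le> f z"
    using opt unfolding locally_optimal_on_def by auto
  obtain r where r: "L > 0" "r > 0" "L-lipschitz_on (ball x r) f"
    using lip unfolding lipschitz_constant_around_def by auto
  \<comment> \<open>Halving the radius keeps near-projections, whose distance to \<open>y\<close> is below \<open>\<rho>\<close>, inside both
    neighbourhoods of \<open>x\<close>.\<close>
  define \<rho> where "\<rho> = min \<delta> r / 2"
  have \<rho>: "\<rho> > 0" "2 * \<rho> \<le> \<delta>" "2 * \<rho> \<le> r"
    using \<delta>(2) r(2) by (auto simp: \<rho>_def)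
  have "f x \<le> f y + L * infdist y F" if "y \<in> ball x \<rho>" for y
  proof -
    have y: "dist x y < \<rho>"
      using that by simp
    have near: "infdist y F < \<rho>"
      using infdist_le[OF \<delta>(1), of y] y by (simp add: dist_commute)
    have "(f x - f y) / L \<le> t" if t: "infdist y F < t" "t < \<rho>" for t
    proof -
      obtain z where z: "z \<in> F" "dist y z < t"
        using t(1) \<delta>(1) cINF_less_iff[of F "dist y" t] infdist_notempty[of F y]
        by (metis bdd_below_image_dist empty_iff)
      have "dist x z < 2 * \<rho>"
        using dist_triangle[of x z y] y z(2) t(2) by linarith
      then have "f x \<le> f z" "z \<in> ball x r" "y \<in> ball x r"
        using \<delta>(3)[OF z(1)] \<rho> y by auto
      moreover from this have "f z - f y \<le> L * dist y z"
        using lipschitz_onD[OF r(3), of z y] by (simp add: dist_real_def dist_commute)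
      moreover have "L * dist y z \<le> L * t"
        using z(2) r(1) by simp
      ultimately have "f x - f y \<le> L * t"
        by linarith
      then show ?thesis
        using r(1) by (simp add: pos_divide_le_eq mult.commute)
    qed
    then have "(f x - f y) / L \<le> infdist y F"
      using dense_ge_bounded[OF near] by blast
    then show ?thesis
      using r(1) by (simp add: field_simps)
  qed
  then show ?thesis
    using \<rho>(1) by blast
qed

lemma error_bound_imp_solves_penalty_locally:
  assumes opt: "locally_optimal_on f F x" and lip: "lipschitz_constant_around f x L"
    and bound: "local_error_bound F R \<alpha> x"
    and R: "R x = 0" "\<And>y. 0 \<le> R y" and \<kappa>: "\<alpha> * L \<le> \<kappa>"
  shows "solves_penalty_locally f R \<kappa> x"
proof -
  obtain \<rho> where \<rho>: "\<rho> > 0" "\<And>y. y \<in> ball x \<rho> \<Longrightarrow> f x \<le> f y + L * infdist y F"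
    using lipschitz_distance_penalty[OF opt lip] by blast
  obtain \<epsilon> where \<epsilon>: "\<epsilon> > 0" "\<And>y. dist y x < \<epsilon> \<Longrightarrow> infdist y F \<le> \<alpha> * R y"
    using bound unfolding local_error_bound_def by blast
  have "L > 0"
    using lip unfolding lipschitz_constant_around_def by blast
  have "f x + \<kappa> * R x \<le> f y + \<kappa> * R y" if "y \<in> ball x (min \<rho> \<epsilon>)" for y
  proof -
    have "f x \<le> f y + L * infdist y F"
      using \<rho>(2) that by simp
    moreover have "L * infdist y F \<le> L * (\<alpha> * R y)"
      using \<epsilon>(2)[of y] that \<open>L > 0\<close> by (simp add: dist_commute)
    moreover have "L * (\<alpha> * R y) \<le> \<kappa> * R y"
      using mult_right_mono[OF \<kappa> R(2)[of y]] by (simp add: mult_ac)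
    ultimately show ?thesis
      using R(1) by simp
  qed
  then show ?thesis
    using \<rho>(1) \<epsilon>(1) unfolding solves_penalty_locally_def locally_optimal_on_def
    by (auto intro!: exI[of _ "min \<rho> \<epsilon>"])
qed

lemma mpsc_residual_nonneg: "0 \<le> mpsc_residual m p l g h G H y"
  unfolding mpsc_residual_def by (intro real_sqrt_ge_zero add_nonneg_nonneg sum_nonneg) auto

lemma mpsc_residual_eq_0:
  assumes "x \<in> mpsc_feasible m p l g h G H"
  shows "mpsc_residual m p l g h G H x = 0"
proof -
  have "min ((G k x)\<^sup>2) ((H k x)\<^sup>2) = 0" if "k \<in> {1..l}" for k
  proof -
    have "G k x = 0 \<or> H k x = 0"
      using assms that unfolding mpsc_feasible_def by auto
    then show ?thesis
      by (auto simp: min_def)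
  qed
  moreover have "max (g i x) 0 = 0" if "i \<in> {1..m}" for i
    using assms that unfolding mpsc_feasible_def by auto
  moreover have "h j x = 0" if "j \<in> {1..p}" for j
    using assms that unfolding mpsc_feasible_def by auto
  ultimately show ?thesis
    unfolding mpsc_residual_def by simp
qed

theorem theorem6p1:
  fixes m p l :: nat
    and f :: "real ^ 'n \<Rightarrow> real"
    and g h G H :: "nat \<Rightarrow> real ^ 'n \<Rightarrow> real"
    and xbar :: "real ^ 'n"
    and \<alpha> :: real
  assumes "twice_continuously_differentiable f"
    and "\<And>i. i \<in> {1..m} \<Longrightarrow> twice_continuously_differentiable (g i)"
    and "\<And>j. j \<in> {1..p} \<Longrightarrow> twice_continuously_differentiable (h j)"
    and "\<And>k. k \<in> {1..l} \<Longrightarrow> twice_continuously_differentiable (G k)"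
    and "\<And>k. k \<in> {1..l} \<Longrightarrow> twice_continuously_differentiable (H k)"
    and "locally_optimal_on f (mpsc_feasible m p l g h G H) xbar"
    and "local_error_bound (mpsc_feasible m p l g h G H) (mpsc_residual m p l g h G H) \<alpha> xbar"
  shows "admits_local_exact_penalization f (mpsc_residual m p l g h G H) xbar \<and>
         (\<exists>L. lipschitz_constant_around f xbar L) \<and>
         (\<forall>L. lipschitz_constant_around f xbar L \<longrightarrow>
            \<alpha> * L > 0 \<and>
            (\<forall>\<kappa>>\<alpha> * L. solves_penalty_locally f (mpsc_residual m p l g h G H) \<kappa> xbar))"
proof -
  let ?R = "mpsc_residual m p l g h G H"
  have "xbar \<in> mpsc_feasible m p l g h G H" "\<alpha> > 0"
    using assms(7) unfolding local_error_bound_def by auto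
  then have penalty: "solves_penalty_locally f ?R \<kappa> xbar"
    if "lipschitz_constant_around f xbar L" "\<kappa> > \<alpha> * L" for L \<kappa>
    using error_bound_imp_solves_penalty_locally[OF assms(6) that(1) assms(7)] that(2)
    by (simp add: mpsc_residual_eq_0 mpsc_residual_nonneg)
  have pos: "\<alpha> * L > 0" if "lipschitz_constant_around f xbar L" for L
    using that \<open>\<alpha> > 0\<close> unfolding lipschitz_constant_around_def by simp
  obtain L where "lipschitz_constant_around f xbar L"
    using twice_continuously_differentiable_imp_lipschitz_constant[OF assms(1)] by blast
  then show ?thesis
    using penalty pos unfolding admits_local_exact_penalization_def by blast
qed

end
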